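(* Let $x$ be a positive real number and let $\alpha(x),\omega_1(x),\omega_2(x)$ be the three roots in $\mathbb{C}$ of $\lambda^3-x^2\lambda^2-x\lambda-1=0$. Put $\underline{\alpha}=1+\alpha(x)\mathbf{i}+\alpha^2(x)\mathbf{j}+\alpha^3(x)\mathbf{k}$, $\underline{\omega_1}=1+\omega_1(x)\mathbf{i}+\omega_1^2(x)\mathbf{j}+\omega_1^3(x)\mathbf{k}$ and $\underline{\omega_2}=1+\omega_2(x)\mathbf{i}+\omega_2^2(x)\mathbf{j}+\omega_2^3(x)\mathbf{k}$. Then the exponential generating functions of the Tribonacci and Tribonacci-Lucas quaternion polynomials are $$\sum_{n=0}^{\infty}\frac{Q_{T,n}(x)}{n!}y^n=\frac{\underline{\alpha}\,\alpha(x)e^{\alpha(x)y}}{(\alpha(x)-\omega_1(x))(\alpha(x)-\omega_2(x))}-\frac{\underline{\omega_1}\,\omega_1(x)e^{\omega_1(x)y}}{(\alpha(x)-\omega_1(x))(\omega_1(x)-\omega_2(x))}+\frac{\underline{\omega_2}\,\omega_2(x)e^{\omega_2(x)y}}{(\alpha(x)-\omega_2(x))(\omega_1(x)-\omega_2(x))}$$ and $$\sum_{n=0}^{\infty}\frac{Q_{t,n}(x)}{n!}y^n=\underline{\alpha}\,e^{\alpha(x)y}+\underline{\omega_1}\,e^{\omega_1(x)y}+\underline{\omega_2}\,e^{\omega_2(x)y},$$ respectively.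
   Context: The Tribonacci polynomials $T_n(x)$ and Tribonacci-Lucas polynomials $t_n(x)$ are defined by $T_0(x)=0$, $T_1(x)=1$, $T_2(x)=x^2$, $t_0(x)=3$, $t_1(x)=x^2$, $t_2(x)=x^4+2x$, and for $n\ge 3$: $T_n(x)=x^2T_{n-1}(x)+xT_{n-2}(x)+T_{n-3}(x)$ and $t_n(x)=x^2t_{n-1}(x)+xt_{n-2}(x)+t_{n-3}(x)$. Let $\mathbf{i},\mathbf{j},\mathbf{k}$ be the quaternion units, with $\mathbf{i}^2=\mathbf{j}^2=\mathbf{k}^2=\mathbf{i}\mathbf{j}\mathbf{k}=-1$. For $n\ge 0$, the Tribonacci quaternion polynomials are $Q_{T,n}(x)=T_n(x)+T_{n+1}(x)\mathbf{i}+T_{n+2}(x)\mathbf{j}+T_{n+3}(x)\mathbf{k}$ and the Tribonacci-Lucas quaternion polynomials are $Q_{t,n}(x)=t_n(x)+t_{n+1}(x)\mathbf{i}+t_{n+2}(x)\mathbf{j}+t_{n+3}(x)\mathbf{k}$. Since the roots may be non-real complex numbers, the identities are understood with coefficients in the complexified quaternion algebra $\mathbb{C}\otimes_{\mathbb{R}}\mathbb{H}$, in which complex scalars commute with $\mathbf{i},\mathbf{j},\mathbf{k}$ (the complex imaginary unit is distinct from $\mathbf{i}$). Generating functions are formal power series in an indeterminate $y$ commuting with all coefficients, with $e^{cy}=\sum_{n\ge 0}c^ny^n/n!$ for $c\in\mathbb{C}$. Powers such as $\alpha^2(x)$ mean $(\alpha(x))^2$. *)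

theory Defs
  imports "HOL-Computational_Algebra.Computational_Algebra"
begin

text \<open>
  The quaternion algebra over a commutative ring: \<open>Quat a b c d\<close> stands for
  \<open>a + b i + c j + d k\<close>.  The type \<open>real quat\<close> is the algebra \<open>H\<close> of real quaternions, and
  \<open>complex quat\<close> is its complexification (the tensor product of \<open>\<complex>\<close> and \<open>H\<close> over \<open>\<real>\<close>): the
  central complex scalars are the elements \<open>quat_of c\<close>, so \<open>quat_of \<i>\<close> differs from \<open>quat_i\<close>.
\<close>

datatype 'a quat = Quat (quat_re: 'a) (quat_im1: 'a) (quat_im2: 'a) (quat_im3: 'a)
  for map: map_quat

instantiation quat :: (comm_ring_1) ring_1
begin

definition zero_quat :: "'a quat" where "0 = Quat 0 0 0 0"

definition one_quat :: "'a quat" where "1 = Quat 1 0 0 0"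

fun plus_quat :: "'a quat \<Rightarrow> 'a quat \<Rightarrow> 'a quat" where
  "Quat a b c d + Quat a' b' c' d' = Quat (a + a') (b + b') (c + c') (d + d')"

fun minus_quat :: "'a quat \<Rightarrow> 'a quat \<Rightarrow> 'a quat" where
  "Quat a b c d - Quat a' b' c' d' = Quat (a - a') (b - b') (c - c') (d - d')"

fun uminus_quat :: "'a quat \<Rightarrow> 'a quat" where
  "- Quat a b c d = Quat (- a) (- b) (- c) (- d)"

fun times_quat :: "'a quat \<Rightarrow> 'a quat \<Rightarrow> 'a quat" where
  "Quat a b c d * Quat a' b' c' d' =
     Quat (a * a' - b * b' - c * c' - d * d')
          (a * b' + b * a' + c * d' - d * c')
          (a * c' - b * d' + c * a' + d * b')
          (a * d' + b * c' - c * b' + d * a')"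

instance
proof
  fix p q r :: "'a quat"
  show "p + q + r = p + (q + r)" by (cases p; cases q; cases r) (simp add: add.assoc)
  show "p + q = q + p" by (cases p; cases q) (simp add: add.commute)
  show "0 + p = p" by (cases p) (simp add: zero_quat_def)
  show "- p + p = 0" by (cases p) (simp add: zero_quat_def)
  show "p - q = p + - q" by (cases p; cases q) simp
  show "p * q * r = p * (q * r)" by (cases p; cases q; cases r) (simp add: algebra_simps)
  show "1 * p = p" by (cases p) (simp add: one_quat_def)
  show "p * 1 = p" by (cases p) (simp add: one_quat_def)
  show "(p + q) * r = p * r + q * r" by (cases p; cases q; cases r) (simp add: algebra_simps)
  show "p * (q + r) = p * q + p * r" by (cases p; cases q; cases r) (simp add: algebra_simps)
  show "(0 :: 'a quat) \<noteq> 1" by (simp add: zero_quat_def one_quat_def)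
qed

end

definition quat_of :: "'a::comm_ring_1 \<Rightarrow> 'a quat" where "quat_of a = Quat a 0 0 0"

definition quat_i :: "'a::comm_ring_1 quat" where "quat_i = Quat 0 1 0 0"

definition quat_j :: "'a::comm_ring_1 quat" where "quat_j = Quat 0 0 1 0"

definition quat_k :: "'a::comm_ring_1 quat" where "quat_k = Quat 0 0 0 1"

lemma quat_units:
  "quat_i * quat_i = (- 1 :: 'a::comm_ring_1 quat)"
  "quat_j * quat_j = (- 1 :: 'a quat)"
  "quat_k * quat_k = (- 1 :: 'a quat)"
  "quat_i * quat_j * quat_k = (- 1 :: 'a quat)"
  by (simp_all add: quat_i_def quat_j_def quat_k_def one_quat_def)

lemma quat_of_hom:
  "quat_of 0 = 0" "quat_of 1 = 1" "quat_of (- a) = - quat_of a"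
  "quat_of (a + b) = quat_of a + quat_of b" "quat_of (a - b) = quat_of a - quat_of b"
  "quat_of (a * b) = quat_of a * quat_of b"
  by (simp_all add: quat_of_def zero_quat_def one_quat_def)

lemma quat_of_central: "quat_of a * q = q * quat_of a"
  by (cases q) (simp add: quat_of_def mult.commute)

lemma Quat_eq_units:
  "Quat a b c d = quat_of a + quat_of b * quat_i + quat_of c * quat_j + quat_of d * quat_k"
  by (simp add: quat_of_def quat_i_def quat_j_def quat_k_def)

text \<open>The canonical embedding of the real quaternions into the complexified ones.\<close>

definition quat_complexify :: "real quat \<Rightarrow> complex quat" where
  "quat_complexify = map_quat complex_of_real"

fun tribonacci_poly :: "nat \<Rightarrow> real poly" where
  "tribonacci_poly 0 = 0"
| "tribonacci_poly (Suc 0) = 1"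
| "tribonacci_poly (Suc (Suc 0)) = [:0, 1:] ^ 2"
| "tribonacci_poly (Suc (Suc (Suc n))) =
     [:0, 1:] ^ 2 * tribonacci_poly (Suc (Suc n)) + [:0, 1:] * tribonacci_poly (Suc n)
       + tribonacci_poly n"

fun tribonacci_lucas_poly :: "nat \<Rightarrow> real poly" where
  "tribonacci_lucas_poly 0 = 3"
| "tribonacci_lucas_poly (Suc 0) = [:0, 1:] ^ 2"
| "tribonacci_lucas_poly (Suc (Suc 0)) = [:0, 1:] ^ 4 + 2 * [:0, 1:]"
| "tribonacci_lucas_poly (Suc (Suc (Suc n))) =
     [:0, 1:] ^ 2 * tribonacci_lucas_poly (Suc (Suc n)) + [:0, 1:] * tribonacci_lucas_poly (Suc n)
       + tribonacci_lucas_poly n"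

definition tribonacci_quat :: "nat \<Rightarrow> real \<Rightarrow> real quat" where
  "tribonacci_quat n x =
     quat_of (poly (tribonacci_poly n) x)
     + quat_of (poly (tribonacci_poly (n + 1)) x) * quat_i
     + quat_of (poly (tribonacci_poly (n + 2)) x) * quat_j
     + quat_of (poly (tribonacci_poly (n + 3)) x) * quat_k"

definition tribonacci_lucas_quat :: "nat \<Rightarrow> real \<Rightarrow> real quat" where
  "tribonacci_lucas_quat n x =
     quat_of (poly (tribonacci_lucas_poly n) x)
     + quat_of (poly (tribonacci_lucas_poly (n + 1)) x) * quat_i
     + quat_of (poly (tribonacci_lucas_poly (n + 2)) x) * quat_j
     + quat_of (poly (tribonacci_lucas_poly (n + 3)) x) * quat_k"

text \<open>The underlined quaternion attached to a root.\<close>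

definition quat_root :: "complex \<Rightarrow> complex quat" where
  "quat_root z = 1 + quat_of z * quat_i + quat_of (z ^ 2) * quat_j + quat_of (z ^ 3) * quat_k"

text \<open>
  Formal power series in \<open>y\<close> over the complexified quaternions.  The indeterminate of
  \<^typ>\<open>complex quat fps\<close> commutes with all coefficients by construction of \<^typ>\<open>'a fps\<close>.
\<close>

definition quat_egf :: "(nat \<Rightarrow> complex quat) \<Rightarrow> complex quat fps" where
  "quat_egf q = Abs_fps (\<lambda>n. quat_of (1 / fact n) * q n)"

text \<open>The series \<open>e\<^sup>c\<^sup>y\<close>, with its complex coefficients embedded as central scalars.\<close>

definition quat_fps_exp :: "complex \<Rightarrow> complex quat fps" where
  "quat_fps_exp c = Abs_fps (\<lambda>n. quat_of (fps_nth (fps_exp c) n))"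

end

theory Submission
  imports Defs
begin

text \<open>
  Multiplying a quaternion-valued constant into the series of \<open>e\<^sup>c\<^sup>y\<close> gives the exponential
  generating function of a geometric sequence, and in the algebra over \<open>\<complex>\<close> the geometric sequence
  \<open>z\<^sup>n\<close> times the underlined quaternion of \<open>z\<close> has the entries
  \<open>z\<^sup>n, z\<^sup>n\<^sup>+\<^sup>1, z\<^sup>n\<^sup>+\<^sup>2, z\<^sup>n\<^sup>+\<^sup>3\<close> (\<open>geometric_quat_root\<close>).  The quaternion identities are thus, entry by
  entry, the scalar Binet formulas for the two polynomial sequences at \<open>x\<close>.

  A Binet formula holds because both of its sides solve the recurrence whose characteristic
  polynomial has the given roots, and such a solution is determined by three consecutive values
  (\<open>third_order_recurrence_unique\<close>); Vieta's formulas (\<open>cubic_vieta\<close>) identify the initial values.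
  For the Tribonacci-Lucas sequence these are power sums of the roots.  For the Tribonacci sequence
  the formula is first obtained multiplied by the Vandermonde product of the roots, which may be
  cancelled because the roots are distinct: the square of that product is the discriminant
  \<open>- 3 x\<^sup>6 - 14 x\<^sup>3 - 27\<close>, which is negative for \<open>x > 0\<close> (\<open>vandermonde_nonzero\<close>).
\<close>

lemma cubic_vieta:
  fixes a b c :: complex
  assumes "proots [:r, q, p, 1:] = {#a, b, c#}"
  shows "p = - (a + b + c)" "q = a * b + a * c + b * c" "r = - (a * b * c)"
proof -
  have "[:r, q, p, 1:] = (\<Prod>z\<in>#{#a, b, c#}. [:- z, 1:])"
    using complex_poly_decompose_multiset[of "[:r, q, p, 1:]"] by (simp flip: assms)
  also have "\<dots> = [:- a, 1:] * [:- b, 1:] * [:- c, 1:]"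
    by (simp only: image_mset_add_mset image_mset_empty prod_mset.add_mset prod_mset.empty
        mult_1_right mult.assoc)
  also have "\<dots> = [:- (a * b * c), a * b + a * c + b * c, - (a + b + c), 1:]"
    by (simp add: algebra_simps)
  finally show "p = - (a + b + c)" "q = a * b + a * c + b * c" "r = - (a * b * c)"
    unfolding pCons_eq_iff by blast+
qed

lemma third_order_recurrence_unique:
  fixes u v :: "nat \<Rightarrow> 'a::comm_ring_1"
  assumes u: "\<And>n. u (n + 3) = p * u (n + 2) + q * u (n + 1) + r * u n"
    and v: "\<And>n. v (n + 3) = p * v (n + 2) + q * v (n + 1) + r * v n"
    and init: "u 0 = v 0" "u 1 = v 1" "u 2 = v 2"
  shows "u n = v n"
proof (induction n rule: less_induct)
  case (less n)
  have "n = 0 \<or> n = 1 \<or> n = 2 \<or> (\<exists>m. n = m + 3)"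
    by presburger
  then consider "n = 0" | "n = 1" | "n = 2" | m where "n = m + 3"
    by blast
  then show ?case
  proof cases
    case 4
    then show ?thesis using less[of m] less[of "m + 1"] less[of "m + 2"] u[of m] v[of m] by simp
  qed (use init in simp_all)
qed

locale cubic_roots =
  fixes x :: real and a b c :: complex
  assumes pos: "x > 0"
    and sum_roots: "a + b + c = of_real x ^ 2"
    and sum_pairs: "a * b + a * c + b * c = - of_real x"
    and prod_roots: "a * b * c = 1"
begin

text \<open>
  The square of this product is the discriminant, a symmetric function of the roots and hence a
  polynomial in the coefficients; on the given cubic it is a negative real number.
\<close>

lemma vandermonde_nonzero: "(a - b) * (a - c) * (b - c) \<noteq> 0"
proof
  assume zero: "(a - b) * (a - c) * (b - c) = 0"
  have "((a - b) * (a - c) * (b - c))\<^sup>2 =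
      (a + b + c)^2 * (a * b + a * c + b * c)^2 - 4 * (a * b + a * c + b * c)^3
      - 4 * (a + b + c)^3 * (a * b * c) - 27 * (a * b * c)^2
      + 18 * (a + b + c) * (a * b + a * c + b * c) * (a * b * c)"
    by algebra
  also have "\<dots> = of_real (- 3 * x ^ 6 - 14 * x ^ 3 - 27)"
    unfolding sum_roots sum_pairs prod_roots by (simp, algebra)
  finally have "- 3 * x ^ 6 - 14 * x ^ 3 - 27 = 0"
    unfolding zero by (metis of_real_eq_0_iff zero_power2)
  moreover have "x ^ 6 > 0" "x ^ 3 > 0" using pos by simp_all
  ultimately show False by linarith
qed

lemma root_equation:
  assumes "z \<in> {a, b, c}"
  shows "z ^ 3 = of_real x ^ 2 * z ^ 2 + of_real x * z + 1"
proof -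
  have "z ^ 3 - (a + b + c) * z ^ 2 + (a * b + a * c + b * c) * z - a * b * c = 0"
    using assms by (auto simp: algebra_simps power2_eq_square power3_eq_cube)
  then show ?thesis
    unfolding sum_roots sum_pairs prod_roots by (simp add: algebra_simps)
qed

lemma root_power_recurrence:
  assumes "z \<in> {a, b, c}"
  shows "z ^ (n + 3) = of_real x ^ 2 * z ^ (n + 2) + of_real x * z ^ (n + 1) + 1 * z ^ n"
  by (simp only: power_add root_equation[OF assms]) (simp add: algebra_simps)

text \<open>
  With denominators cleared, the three initial values are ring identities: both sides vanish at \<open>0\<close>,
  and at \<open>1\<close> and \<open>2\<close> the right-hand side is the Vandermonde product times \<open>1\<close> and the sum of the roots.
\<close>

lemma tribonacci_binet_cleared:
  "of_real (poly (tribonacci_poly n) x) * ((a - b) * (a - c) * (b - c)) =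
     a ^ (n + 1) * (b - c) - b ^ (n + 1) * (a - c) + c ^ (n + 1) * (a - b)"
proof (rule third_order_recurrence_unique
    [where u = "\<lambda>n. of_real (poly (tribonacci_poly n) x) * ((a - b) * (a - c) * (b - c))"
      and p = "of_real x ^ 2" and q = "of_real x" and r = 1], goal_cases)
  case (1 n)
  have "of_real (poly (tribonacci_poly (n + 3)) x) =
      (of_real x ^ 2 * of_real (poly (tribonacci_poly (n + 2)) x)
       + of_real x * of_real (poly (tribonacci_poly (n + 1)) x)
       + of_real (poly (tribonacci_poly n) x) :: complex)"
    by (simp add: numeral_3_eq_3)
  then show ?case by (simp only: distrib_right mult.assoc mult_1_left)
next
  case (2 n)
  show ?case
    using root_power_recurrence[of a "n + 1"] root_power_recurrence[of b "n + 1"]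
      root_power_recurrence[of c "n + 1"]
    by (simp add: add_ac) (simp add: algebra_simps)
next
  case 5
  have "of_real (poly (tribonacci_poly 2) x) = a + b + c"
    by (simp add: numeral_2_eq_2 sum_roots)
  moreover have "(a + b + c) * ((a - b) * (a - c) * (b - c)) =
      a ^ 3 * (b - c) - b ^ 3 * (a - c) + c ^ 3 * (a - b)"
    by algebra
  ultimately show ?case by simp
qed (simp_all, algebra+)

lemma tribonacci_binet:
  "of_real (poly (tribonacci_poly n) x) =
     a / ((a - b) * (a - c)) * a ^ n - b / ((a - b) * (b - c)) * b ^ n
     + c / ((a - c) * (b - c)) * c ^ n"
proof -
  have "a - b \<noteq> 0" "a - c \<noteq> 0" "b - c \<noteq> 0" using vandermonde_nonzero by auto
  then show ?thesis
    using tribonacci_binet_cleared[of n] by (simp add: divide_simps) (simp add: mult_ac)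
qed

lemma tribonacci_lucas_binet:
  "of_real (poly (tribonacci_lucas_poly n) x) = a ^ n + b ^ n + c ^ n"
proof (rule third_order_recurrence_unique
    [where p = "of_real x ^ 2" and q = "of_real x" and r = 1], goal_cases)
  case (1 n)
  show ?case by (simp add: numeral_3_eq_3)
next
  case (2 n)
  show ?case
    using root_power_recurrence[of a n] root_power_recurrence[of b n] root_power_recurrence[of c n]
    by (simp add: add_ac) (simp add: algebra_simps)
next
  case 4
  show ?case by (simp add: sum_roots)
next
  case 5
  \<comment> \<open>Newton's identity for the second power sum.\<close>
  have "a ^ 2 + b ^ 2 + c ^ 2 = (a + b + c) ^ 2 - 2 * (a * b + a * c + b * c)"
    by algebra
  also have "\<dots> = of_real (poly (tribonacci_lucas_poly 2) x)"
    unfolding sum_roots sum_pairs by (simp add: numeral_2_eq_2) algebra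
  finally show ?case by simp
qed simp

end

lemma quat_egf_add: "quat_egf (\<lambda>n. f n + g n) = quat_egf f + quat_egf g"
  by (simp add: quat_egf_def fps_eq_iff distrib_left)

lemma quat_egf_diff: "quat_egf (\<lambda>n. f n - g n) = quat_egf f - quat_egf g"
  by (simp add: quat_egf_def fps_eq_iff right_diff_distrib)

text \<open>
  The scalar \<open>1 / n!\<close> stands to the left of the coefficient in \<^const>\<open>quat_egf\<close> and to its right in the
  product; the two agree because complex scalars are central.
\<close>

lemma fps_const_times_quat_fps_exp:
  "fps_const q * quat_fps_exp z = quat_egf (\<lambda>n. q * quat_of (z ^ n))"
proof -
  have "q * quat_of (z ^ n / fact n) = quat_of (1 / fact n) * (q * quat_of (z ^ n))" for n
    using quat_of_central[of "1 / fact n" "q * quat_of (z ^ n)"]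
    by (simp add: mult.assoc flip: quat_of_hom(6))
  then show ?thesis
    by (simp add: quat_fps_exp_def quat_egf_def fps_eq_iff)
qed

lemma geometric_quat_root:
  "quat_root z * quat_of w * quat_of (z ^ n) =
     Quat (w * z ^ n) (w * z ^ (n + 1)) (w * z ^ (n + 2)) (w * z ^ (n + 3))"
  by (simp add: quat_root_def one_quat_def quat_of_def quat_i_def quat_j_def quat_k_def
      power_add power2_eq_square power3_eq_cube mult_ac)

lemma quat_complexify_tribonacci:
  "quat_complexify (tribonacci_quat n x) =
     (let t = \<lambda>m. of_real (poly (tribonacci_poly m) x)
      in Quat (t n) (t (n + 1)) (t (n + 2)) (t (n + 3)))"
  unfolding tribonacci_quat_def Quat_eq_units[symmetric] quat_complexify_def Let_def by simp

lemma quat_complexify_tribonacci_lucas: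
  "quat_complexify (tribonacci_lucas_quat n x) =
     (let t = \<lambda>m. of_real (poly (tribonacci_lucas_poly m) x)
      in Quat (t n) (t (n + 1)) (t (n + 2)) (t (n + 3)))"
  unfolding tribonacci_lucas_quat_def Quat_eq_units[symmetric] quat_complexify_def Let_def by simp

theorem theorem2p6:
  fixes x :: real and \<alpha> \<omega>\<^sub>1 \<omega>\<^sub>2 :: complex
  assumes "x > 0"
    and "proots [:- 1, - complex_of_real x, - (complex_of_real x ^ 2), 1:] = {#\<alpha>, \<omega>\<^sub>1, \<omega>\<^sub>2#}"
  shows "quat_egf (\<lambda>n. quat_complexify (tribonacci_quat n x)) =
           fps_const (quat_root \<alpha> * quat_of (\<alpha> / ((\<alpha> - \<omega>\<^sub>1) * (\<alpha> - \<omega>\<^sub>2)))) * quat_fps_exp \<alpha>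
         - fps_const (quat_root \<omega>\<^sub>1 * quat_of (\<omega>\<^sub>1 / ((\<alpha> - \<omega>\<^sub>1) * (\<omega>\<^sub>1 - \<omega>\<^sub>2)))) * quat_fps_exp \<omega>\<^sub>1
         + fps_const (quat_root \<omega>\<^sub>2 * quat_of (\<omega>\<^sub>2 / ((\<alpha> - \<omega>\<^sub>2) * (\<omega>\<^sub>1 - \<omega>\<^sub>2)))) * quat_fps_exp \<omega>\<^sub>2
       \<and> quat_egf (\<lambda>n. quat_complexify (tribonacci_lucas_quat n x)) =
           fps_const (quat_root \<alpha>) * quat_fps_exp \<alpha>
         + fps_const (quat_root \<omega>\<^sub>1) * quat_fps_exp \<omega>\<^sub>1
         + fps_const (quat_root \<omega>\<^sub>2) * quat_fps_exp \<omega>\<^sub>2"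
proof -
  interpret cubic_roots x \<alpha> \<omega>\<^sub>1 \<omega>\<^sub>2
  proof
    note vieta = cubic_vieta[OF assms(2)]
    show "\<alpha> + \<omega>\<^sub>1 + \<omega>\<^sub>2 = complex_of_real x ^ 2" using vieta(1) by (metis neg_equal_iff_equal)
    show "\<alpha> * \<omega>\<^sub>1 + \<alpha> * \<omega>\<^sub>2 + \<omega>\<^sub>1 * \<omega>\<^sub>2 = - complex_of_real x" using vieta(2) by simp
    show "\<alpha> * \<omega>\<^sub>1 * \<omega>\<^sub>2 = 1" using vieta(3) by simp
  qed (fact assms(1))
  \<comment> \<open>The scalar \<open>1\<close> brings the Tribonacci-Lucas summands into the shape of the Tribonacci ones.\<close>
  have root_1: "quat_root z * quat_of (z ^ n) = quat_root z * quat_of 1 * quat_of (z ^ n)" for z n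
    by (simp add: quat_of_hom(2))
  show ?thesis
    unfolding fps_const_times_quat_fps_exp root_1 geometric_quat_root
      quat_complexify_tribonacci quat_complexify_tribonacci_lucas Let_def
      tribonacci_binet tribonacci_lucas_binet
      quat_egf_add[symmetric] quat_egf_diff[symmetric]
    by simp
qed

end
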